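(* Let $f \in \mathbb{R}[x_1,\dots,x_n]$ be a homogeneous polynomial of degree $d$, hyperbolic with respect to $e \in \mathbb{R}^n$, and let $\ell\colon\mathbb{R}^n\to\mathbb{R}$ be a linear map such that $\ell(x)$ and $e^Tx$ are linearly independent linear forms. Let $\ell^*=\inf\{\ell(x) : x\in\Lambda_+'\}$. Let $x^*\in\Lambda_+'$ with $\ell(x^* )=\ell^*$, and let $m^*=\mathrm{mult}(x^* )$. Then $x^*$ is a local minimizer of $\ell$ on $\Gamma'_{m^*}$.
   Context: A homogeneous polynomial $f\in\mathbb{R}[x]=\mathbb{R}[x_1,\dots,x_n]$ of degree $d$ is hyperbolic with respect to $e\in\mathbb{R}^n$ if $f(e)\neq 0$ and, for every $a\in\mathbb{R}^n$, the univariate polynomial $f(te-a)\in\mathbb{R}[t]$ has only real roots. Up to rescaling, $f$ is normalized so that $f(e)=1$. The characteristic polynomial of $a\in\mathbb{R}^n$ is $\mathrm{ch}_a(t)=f(te-a)$; its ordered roots $\lambda_1(a)\le\lambda_2(a)\le\cdots\le\lambda_d(a)$ are the eigenvalues of $a$. The multiplicity $\mathrm{mult}(a)$ is the multiplicity of $t=0$ as a root of $\mathrm{ch}_a(t)$ (equal to $0$ if $t=0$ is not a root). The hyperbolicity cone is $\Lambda_+=\{x\in\mathbb{R}^n : \lambda_1(x)\ge 0\}$, which is the Euclidean closure of the open cone $\Lambda_{++}=\{x\in\mathbb{R}^n:\lambda_1(x)>0\}$. Let $\Gamma_m=\{a\in\mathbb{R}^n : \mathrm{mult}(a)\ge m\}$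 for $0\le m\le d$. Let $L_e=\{x\in\mathbb{R}^n : e^Tx=1\}$, $\Lambda_+'=\Lambda_+\cap L_e$, and $\Gamma_m'=\Gamma_m\cap L_e$. A local minimizer of a continuous function $\ell\colon\mathbb{R}^n\to\mathbb{R}$ on a set $S\subset\mathbb{R}^n$ is a point $x^*\in S$ such that there is an open set $U\subset\mathbb{R}^n$ with $x^*\in U$ and $\ell(x^* )\le\ell(x)$ for all $x\in U\cap S$. *)

theory Defs
  imports
    "HOL-Analysis.Analysis"
    "HOL-Computational_Algebra.Computational_Algebra"
    "HOL-Library.Poly_Mapping"
begin

text \<open>
  Real polynomials in variables indexed by the finite type \<open>'n\<close>: finitely supported maps from
  exponent vectors to coefficients.
\<close>

type_synonym 'n rmpoly = "('n \<Rightarrow>\<^sub>0 nat) \<Rightarrow>\<^sub>0 real"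

text \<open>The value of \<open>f\<close> at the point \<open>v\<close> of a ring whose scalars are embedded by \<open>c\<close>.\<close>

definition subst_poly ::
    "(real \<Rightarrow> 'r::comm_ring_1) \<Rightarrow> ('n::finite) rmpoly \<Rightarrow> ('n \<Rightarrow> 'r) \<Rightarrow> 'r" where
  "subst_poly c f v =
     (\<Sum>\<alpha>\<in>Poly_Mapping.keys f.
        c (Poly_Mapping.lookup f \<alpha>) * (\<Prod>i\<in>UNIV. v i ^ Poly_Mapping.lookup \<alpha> i))"

definition eval_poly :: "('n::finite) rmpoly \<Rightarrow> real ^ 'n \<Rightarrow> real" where
  "eval_poly f x = subst_poly (\<lambda>r. r) f (\<lambda>i. x $ i)"

text \<open>
  The zero polynomial is homogeneous of every degree here; a hyperbolic polynomial is nonzero.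
\<close>

definition homogeneous :: "('n::finite) rmpoly \<Rightarrow> nat \<Rightarrow> bool" where
  "homogeneous f d \<longleftrightarrow>
     (\<forall>\<alpha>\<in>Poly_Mapping.keys f. (\<Sum>i\<in>UNIV. Poly_Mapping.lookup \<alpha> i) = d)"

text \<open>
  \<open>f(te - a)\<close> as an element of \<open>\<real>[t]\<close>: the \<open>i\<close>-th variable is replaced by \<open>-a\<^sub>i + e\<^sub>i t\<close>.
\<close>

definition ch :: "('n::finite) rmpoly \<Rightarrow> real ^ 'n \<Rightarrow> real ^ 'n \<Rightarrow> real poly" where
  "ch f e a = subst_poly (\<lambda>r. [:r:]) f (\<lambda>i. [:- (a $ i), e $ i:])"

lemma poly_ch: "poly (ch f e a) t = eval_poly f (t *\<^sub>R e - a)"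
  by (simp add: ch_def eval_poly_def subst_poly_def poly_sum poly_prod algebra_simps)

definition real_rooted :: "real poly \<Rightarrow> bool" where
  "real_rooted p \<longleftrightarrow> (\<forall>z::complex. poly (map_poly complex_of_real p) z = 0 \<longrightarrow> z \<in> \<real>)"

definition hyperbolic :: "('n::finite) rmpoly \<Rightarrow> real ^ 'n \<Rightarrow> bool" where
  "hyperbolic f e \<longleftrightarrow> eval_poly f e \<noteq> 0 \<and> (\<forall>a. real_rooted (ch f e a))"

text \<open>The roots of \<open>ch\<close> in increasing order, repeated according to multiplicity.\<close>

definition eigenvalues :: "('n::finite) rmpoly \<Rightarrow> real ^ 'n \<Rightarrow> real ^ 'n \<Rightarrow> real list" where
  "eigenvalues f e a = sorted_list_of_multiset (proots (ch f e a))"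

text \<open>\<open>eigenvalue f e k a\<close> is \<open>\<lambda>\<^sub>k(a)\<close>, for \<open>k\<close> between \<open>1\<close> and the degree of \<open>f\<close>.\<close>

definition eigenvalue ::
    "('n::finite) rmpoly \<Rightarrow> real ^ 'n \<Rightarrow> nat \<Rightarrow> real ^ 'n \<Rightarrow> real" where
  "eigenvalue f e k a = eigenvalues f e a ! (k - 1)"

definition root_mult :: "('n::finite) rmpoly \<Rightarrow> real ^ 'n \<Rightarrow> real ^ 'n \<Rightarrow> nat" where
  "root_mult f e a = order 0 (ch f e a)"

text \<open>
  The condition is \<open>\<lambda>\<^sub>1(x) \<ge> 0\<close>. The first disjunct occurs, for a hyperbolic \<open>f\<close>, only in
  degree \<open>0\<close>, where there are no eigenvalues and the cone is taken to be the whole space.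
\<close>

definition hyperbolicity_cone :: "('n::finite) rmpoly \<Rightarrow> real ^ 'n \<Rightarrow> (real ^ 'n) set" where
  "hyperbolicity_cone f e = {x. eigenvalues f e x = [] \<or> eigenvalue f e 1 x \<ge> 0}"

definition Gamma_set :: "('n::finite) rmpoly \<Rightarrow> real ^ 'n \<Rightarrow> nat \<Rightarrow> (real ^ 'n) set" where
  "Gamma_set f e m = {a. root_mult f e a \<ge> m}"

definition L_set :: "real ^ ('n::finite) \<Rightarrow> (real ^ 'n) set" where
  "L_set e = {x. e \<bullet> x = 1}"

definition lin_indep_forms ::
    "(real ^ ('n::finite) \<Rightarrow> real) \<Rightarrow> (real ^ 'n \<Rightarrow> real) \<Rightarrow> bool" where
  "lin_indep_forms g h \<longleftrightarrow> (\<forall>a b. (\<forall>x. a * g x + b * h x = 0) \<longrightarrow> a = 0 \<and> b = 0)"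

definition local_minimizer ::
    "(real ^ ('n::finite) \<Rightarrow> real) \<Rightarrow> (real ^ 'n) set \<Rightarrow> real ^ 'n \<Rightarrow> bool" where
  "local_minimizer g S y \<longleftrightarrow>
     y \<in> S \<and> (\<exists>U. open U \<and> y \<in> U \<and> (\<forall>x\<in>U \<inter> S. g y \<le> g x))"

end

theory Submission
  imports Defs
begin

text \<open>
  Near \<open>x\<^sup>*\<close> the set \<open>\<Gamma>\<^sub>m\<close> with \<open>m = mult(x\<^sup>*)\<close> lies inside the hyperbolicity cone, so a minimizer
  over the cone is a local minimizer over \<open>\<Gamma>\<^sub>m\<close>. The reason is continuity of the eigenvalues: at
  \<open>x\<^sup>*\<close> exactly \<open>m\<close> of them vanish and the others are positive. At a nearby point the others are
  still positive, so if the eigenvalue \<open>0\<close> has multiplicity at least \<open>m\<close> there, then it accounts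
  for all the remaining ones and none is negative.

  Continuity of roots can be replaced by continuity of coefficients. The characteristic polynomial
  has degree \<open>d\<close> and leading coefficient \<open>f(e)\<close> at every point (\<open>ch_degree_bound\<close>), and its
  coefficients depend continuously on the point (\<open>continuous_coeff_ch\<close>). For a real-rooted polynomial
  with nonnegative roots, the signs of the coefficients alternate strictly from the multiplicity of
  the root \<open>0\<close> upwards (\<open>alternating_coeffs_if_nonneg_roots\<close>). These finitely many strict
  inequalities hold at \<open>x\<^sup>*\<close>, hence in a neighbourhood; together with the vanishing of the
  coefficients below \<open>m\<close>, which is what membership in \<open>\<Gamma>\<^sub>m\<close> says, they exclude negative roots
  (\<open>nonneg_roots_if_alternating_coeffs\<close>).
\<close>

section \<open>The leading term of the characteristic polynomial\<close>

lemma coeff_mult_at_degree_bounds: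
  fixes p q :: "'a::comm_semiring_0 poly"
  assumes "degree p \<le> m" "degree q \<le> n"
  shows "coeff (p * q) (m + n) = coeff p m * coeff q n"
proof -
  have "coeff p i * coeff q (m + n - i) = 0" if "i \<le> m + n" "i \<noteq> m" for i
  proof (cases "i < m")
    case True
    then have "degree q < m + n - i" using assms by linarith
    then show ?thesis by (simp add: coeff_eq_0)
  next
    case False
    then have "degree p < i" using assms that by linarith
    then show ?thesis by (simp add: coeff_eq_0)
  qed
  then have "(\<Sum>i\<le>m + n. coeff p i * coeff q (m + n - i))
      = (\<Sum>i\<le>m + n. if i = m then coeff p m * coeff q n else 0)"
    by (intro sum.cong) auto
  then show ?thesis by (simp add: coeff_mult)
qed

lemma power_degree_bound:
  fixes p :: "'a::comm_semiring_1 poly"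
  assumes "degree p \<le> 1"
  shows "degree (p ^ n) \<le> n \<and> coeff (p ^ n) n = coeff p 1 ^ n"
proof (induction n)
  case (Suc n)
  have "degree (p * p ^ n) \<le> 1 + n"
    using degree_mult_le[of p "p ^ n"] assms Suc by linarith
  moreover have "coeff (p * p ^ n) (1 + n) = coeff p 1 * coeff p 1 ^ n"
    using coeff_mult_at_degree_bounds[of p 1 "p ^ n" n] assms Suc by simp
  ultimately show ?case by simp
qed simp

lemma prod_degree_bound:
  fixes p :: "'i \<Rightarrow> 'a::comm_semiring_1 poly"
  assumes "finite A" "\<And>i. i \<in> A \<Longrightarrow> degree (p i) \<le> n i"
  shows "degree (prod p A) \<le> sum n A \<and> coeff (prod p A) (sum n A) = (\<Prod>i\<in>A. coeff (p i) (n i))"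
  using assms
proof (induction rule: finite_induct)
  case (insert a A)
  then have IH: "degree (prod p A) \<le> sum n A"
    "coeff (prod p A) (sum n A) = (\<Prod>i\<in>A. coeff (p i) (n i))" and a: "degree (p a) \<le> n a" by auto
  have "degree (p a * prod p A) \<le> n a + sum n A"
    using degree_mult_le[of "p a" "prod p A"] IH(1) a by linarith
  then show ?case
    using coeff_mult_at_degree_bounds[OF a IH(1)] IH(2) insert.hyps by simp
qed simp

text \<open>
  A monomial \<open>x\<^sup>\<alpha>\<close> of total degree \<open>d\<close> becomes a product of \<open>d\<close> linear factors \<open>e\<^sub>i t - a\<^sub>i\<close>, whose
  top coefficient no longer sees \<open>a\<close>. Hence the leading term of \<open>f(te - a)\<close> is \<open>f(e) t\<^sup>d\<close> for
  every \<open>a\<close>, and no eigenvalue escapes to infinity when \<open>a\<close> varies.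
\<close>

lemma ch_degree_bound:
  assumes "homogeneous f d"
  shows "degree (ch f e a) \<le> d" and "coeff (ch f e a) d = eval_poly f e"
proof -
  define M where
    "M \<alpha> = (\<Prod>i\<in>UNIV. [:- (a $ i), e $ i:] ^ Poly_Mapping.lookup \<alpha> i)" for \<alpha>
  have M: "degree (M \<alpha>) \<le> d" "coeff (M \<alpha>) d = (\<Prod>i\<in>UNIV. (e $ i) ^ Poly_Mapping.lookup \<alpha> i)"
    if "\<alpha> \<in> Poly_Mapping.keys f" for \<alpha>
  proof -
    have d: "(\<Sum>i\<in>UNIV. Poly_Mapping.lookup \<alpha> i) = d"
      using assms that by (simp add: homogeneous_def)
    have lin: "degree ([:- (a $ i), e $ i:] ^ k) \<le> k \<and>
        coeff ([:- (a $ i), e $ i:] ^ k) k = (e $ i) ^ k" for i k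
      using power_degree_bound[of "[:- (a $ i), e $ i:]" k] by simp
    have "degree (M \<alpha>) \<le> (\<Sum>i\<in>UNIV. Poly_Mapping.lookup \<alpha> i) \<and>
        coeff (M \<alpha>) (\<Sum>i\<in>UNIV. Poly_Mapping.lookup \<alpha> i)
          = (\<Prod>i\<in>UNIV. coeff ([:- (a $ i), e $ i:] ^ Poly_Mapping.lookup \<alpha> i) (Poly_Mapping.lookup \<alpha> i))"
      unfolding M_def using lin by (intro prod_degree_bound) auto
    then show "degree (M \<alpha>) \<le> d" "coeff (M \<alpha>) d = (\<Prod>i\<in>UNIV. (e $ i) ^ Poly_Mapping.lookup \<alpha> i)"
      using lin d by auto
  qed
  have ch: "ch f e a = (\<Sum>\<alpha>\<in>Poly_Mapping.keys f. smult (Poly_Mapping.lookup f \<alpha>) (M \<alpha>))"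
    by (simp add: ch_def subst_poly_def M_def)
  show "degree (ch f e a) \<le> d"
    unfolding ch using M(1) by (intro degree_sum_le) (auto intro: order_trans[OF degree_smult_le])
  show "coeff (ch f e a) d = eval_poly f e"
    unfolding ch eval_poly_def subst_poly_def by (simp add: coeff_sum M(2))
qed

lemma degree_ch:
  assumes "homogeneous f d" "eval_poly f e \<noteq> 0"
  shows "degree (ch f e a) = d"
  using ch_degree_bound[OF assms(1), of e a] assms(2) by (metis le_antisym le_degree)

section \<open>Continuity of the coefficients\<close>

lemma continuous_coeff_mult:
  fixes P Q :: "'b::topological_space \<Rightarrow> 'a::real_normed_field poly"
  assumes "\<And>k. continuous_on S (\<lambda>x. coeff (P x) k)" "\<And>k. continuous_on S (\<lambda>x. coeff (Q x) k)"
  shows "continuous_on S (\<lambda>x. coeff (P x * Q x) k)"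
  unfolding coeff_mult by (intro continuous_intros assms)

lemma continuous_coeff_power:
  fixes P :: "'b::topological_space \<Rightarrow> 'a::real_normed_field poly"
  assumes "\<And>k. continuous_on S (\<lambda>x. coeff (P x) k)"
  shows "continuous_on S (\<lambda>x. coeff (P x ^ n) k)"
proof (induction n arbitrary: k)
  case (Suc n)
  show ?case unfolding power_Suc by (intro continuous_coeff_mult assms Suc)
qed simp

lemma continuous_coeff_prod:
  fixes P :: "'i \<Rightarrow> 'b::topological_space \<Rightarrow> 'a::real_normed_field poly"
  assumes "finite A" "\<And>i k. i \<in> A \<Longrightarrow> continuous_on S (\<lambda>x. coeff (P i x) k)"
  shows "continuous_on S (\<lambda>x. coeff (\<Prod>i\<in>A. P i x) k)"
  using assms
proof (induction arbitrary: k rule: finite_induct)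
  case (insert a A)
  have "continuous_on S (\<lambda>x. coeff (P a x * (\<Prod>i\<in>A. P i x)) k)"
    using insert by (intro continuous_coeff_mult) auto
  then show ?case using insert.hyps by simp
qed simp

lemma continuous_coeff_ch: "continuous_on UNIV (\<lambda>a. coeff (ch f e a) k)"
proof -
  have lin: "continuous_on UNIV (\<lambda>a. coeff [:- (a $ i), e $ i:] k)" for i :: 'a and k
    by (cases k; cases "k - 1") (auto intro!: continuous_intros)
  show ?thesis
    unfolding ch_def subst_poly_def coeff_sum
    by (intro continuous_on_sum continuous_coeff_mult continuous_coeff_prod continuous_coeff_power
        lin finite continuous_on_const)
qed

section \<open>Real-rooted polynomials and alternating coefficients\<close>

lemma map_poly_of_real_mult:
  "map_poly complex_of_real (p * q) = map_poly complex_of_real p * map_poly complex_of_real q"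
  by (rule poly_eqI) (simp add: coeff_map_poly coeff_mult)

lemma real_rooted_factor:
  assumes "real_rooted (p * q)"
  shows "real_rooted q"
  using assms by (simp add: real_rooted_def map_poly_of_real_mult)

lemma poly_map_of_real: "poly (map_poly complex_of_real p) (of_real x) = of_real (poly p x)"
  by (induction p) (auto simp: map_poly_pCons)

lemma real_rooted_has_root:
  assumes "real_rooted p" "degree p \<noteq> 0"
  obtains r where "poly p r = 0"
proof -
  have "degree (map_poly complex_of_real p) \<noteq> 0"
    using assms(2) by (simp add: degree_map_poly)
  then obtain z where z: "poly (map_poly complex_of_real p) z = 0"
    by (metis constant_degree fundamental_theorem_of_algebra)
  then obtain r where "z = of_real r"
    using assms(1) by (auto simp: real_rooted_def elim: Reals_cases)
  with z show ?thesis by (intro that[of r]) (simp add: poly_map_of_real)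
qed

text \<open>
  The extremal case of Descartes' rule of signs: multiplying a polynomial with strictly alternating
  coefficients by \<open>t - r\<close> with \<open>r > 0\<close> only ever adds terms of the same sign. The factor \<open>lead_coeff p\<close> makes the
  statement independent of the sign of the polynomial.
\<close>

lemma alternating_coeffs_if_pos_roots:
  fixes p :: "real poly"
  assumes "real_rooted p" "p \<noteq> 0" "\<And>t. poly p t = 0 \<Longrightarrow> t > 0" "k \<le> degree p"
  shows "(- 1) ^ (degree p - k) * (lead_coeff p * coeff p k) > 0"
  using assms
proof (induction "degree p" arbitrary: p k)
  case 0
  then show ?case by (auto elim!: degree_eq_zeroE simp flip: power2_eq_square)
next
  case (Suc n)
  obtain r where r: "poly p r = 0"
    using Suc.hyps(2) Suc.prems(1) by (metis real_rooted_has_root nat.distinct(1))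
  then obtain q where p: "p = [:- r, 1:] * q" by (metis dvdE poly_eq_0_iff_dvd)
  have "r > 0" using Suc.prems(3) r .
  have "q \<noteq> 0" using Suc.prems(2) p by auto
  have deg: "degree p = Suc (degree q)"
    unfolding p using \<open>q \<noteq> 0\<close> by (subst degree_mult_eq) auto
  have lead: "lead_coeff p = lead_coeff q" unfolding p by (subst lead_coeff_mult) simp
  have IH: "(- 1) ^ (degree q - j) * (lead_coeff q * coeff q j) > 0" if "j \<le> degree q" for j
    using Suc.hyps(1)[of q j] Suc.hyps(2) Suc.prems(1,3) deg that \<open>q \<noteq> 0\<close> real_rooted_factor p
    by fastforce
  have coeff: "coeff p k = (case k of 0 \<Rightarrow> 0 | Suc j \<Rightarrow> coeff q j) - r * coeff q k"
    unfolding p by (cases k) auto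
  have low: "(- 1) ^ (degree p - k) * (lead_coeff p * - (r * coeff q k)) > 0" if "k \<le> degree q"
  proof -
    have "(- 1) ^ (degree p - k) * (lead_coeff p * - (r * coeff q k))
        = r * ((- 1) ^ (degree q - k) * (lead_coeff q * coeff q k))"
      using that by (simp add: deg lead[unfolded deg] Suc_diff_le)
    then show ?thesis using IH[OF that] \<open>r > 0\<close> by simp
  qed
  show ?case
  proof (cases k)
    case 0
    then show ?thesis using low coeff by simp
  next
    case (Suc j)
    have "j \<le> degree q" using Suc Suc.prems(4) deg by simp
    then have high: "(- 1) ^ (degree p - k) * (lead_coeff p * coeff q j) > 0"
      using IH Suc deg lead[unfolded deg] by simp
    show ?thesis
    proof (cases "k \<le> degree q")
      case True
      have "(- 1) ^ (degree p - k) * (lead_coeff p * coeff p k)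
          = (- 1) ^ (degree p - k) * (lead_coeff p * coeff q j)
            + (- 1) ^ (degree p - k) * (lead_coeff p * - (r * coeff q k))"
        unfolding distrib_left[symmetric] by (simp add: coeff[unfolded Suc] Suc)
      then show ?thesis using high low[OF True] by linarith
    next
      case False
      then show ?thesis using high by (simp add: coeff[unfolded Suc] Suc coeff_eq_0)
    qed
  qed
qed

text \<open>
  Splitting off the factor \<open>t\<^sup>m\<close>, with \<open>m\<close> the multiplicity of the root \<open>0\<close>, shifts the coefficients
  by \<open>m\<close> and leaves only positive roots.
\<close>

lemma alternating_coeffs_if_nonneg_roots:
  fixes p :: "real poly"
  assumes "real_rooted p" "p \<noteq> 0" "\<And>t. poly p t = 0 \<Longrightarrow> t \<ge> 0" "order 0 p \<le> k" "k \<le> degree p"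
  shows "(- 1) ^ (degree p - k) * (lead_coeff p * coeff p k) > 0"
proof -
  let ?m = "order 0 p"
  obtain q where q: "p = monom 1 ?m * q" "\<not> [:- 0, 1:] dvd q"
    using order_decomp[OF assms(2), of 0] by (auto simp: monom_altdef)
  have "q \<noteq> 0" using q(2) by auto
  have deg: "degree p = degree q + ?m"
    using \<open>q \<noteq> 0\<close> by (subst q(1), subst degree_mult_eq) (auto simp: degree_monom_eq)
  have lead: "lead_coeff p = lead_coeff q"
    using arg_cong[OF q(1), of lead_coeff] by (simp only: lead_coeff_mult lead_coeff_monom mult_1)
  have coeff: "coeff p k = coeff q (k - ?m)"
    using assms(4) by (subst q(1)) (simp add: coeff_monom_mult)
  have pos: "t > 0" if "poly q t = 0" for t
  proof -
    have "t \<ge> 0" by (rule assms(3)) (subst q(1), simp add: that)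
    moreover have "t \<noteq> 0" using that q(2) by (auto simp: poly_eq_0_iff_dvd)
    ultimately show ?thesis by simp
  qed
  have "real_rooted q" using assms(1) q(1) real_rooted_factor by metis
  from alternating_coeffs_if_pos_roots[OF this \<open>q \<noteq> 0\<close> pos, of "k - ?m"]
  show ?thesis using assms(4,5) by (simp add: deg lead[unfolded deg] coeff)
qed

text \<open>
  At a negative \<open>t\<close> the alternating signs of the coefficients cancel those of the powers of \<open>t\<close>, so
  all terms of \<open>p(t)\<close> have the same sign and the leading one is nonzero.
\<close>

lemma nonneg_roots_if_alternating_coeffs:
  fixes p :: "real poly"
  assumes "p \<noteq> 0" "\<And>k. k \<le> degree p \<Longrightarrow> (- 1) ^ (degree p - k) * (lead_coeff p * coeff p k) \<ge> 0"
    and "poly p t = 0"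
  shows "t \<ge> 0"
proof (rule ccontr)
  assume "\<not> t \<ge> 0"
  define s where "s = - t"
  have "s > 0" using \<open>\<not> t \<ge> 0\<close> by (simp add: s_def)
  have t: "t = - s" by (simp add: s_def)
  let ?g = "\<lambda>k. (- 1) ^ (degree p - k) * (lead_coeff p * coeff p k) * s ^ k"
  have sign: "(- 1) ^ degree p * t ^ k = (- 1) ^ (degree p - k) * s ^ k" if k: "k \<le> degree p" for k
  proof -
    obtain j where "degree p = k + j" using le_Suc_ex[OF k] by blast
    then show ?thesis unfolding t by (cases "even k") (simp_all add: power_add)
  qed
  have "(- 1) ^ degree p * lead_coeff p * poly p t
      = (\<Sum>k\<le>degree p. (- 1) ^ degree p * lead_coeff p * (coeff p k * t ^ k))"
    by (simp add: poly_altdef sum_distrib_left)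
  also have "\<dots> = (\<Sum>k\<le>degree p. ?g k)"
  proof (rule sum.cong)
    fix k assume "k \<in> {..degree p}"
    then have "(- 1) ^ degree p * t ^ k = (- 1) ^ (degree p - k) * s ^ k" by (simp add: sign)
    then have "lead_coeff p * coeff p k * ((- 1) ^ degree p * t ^ k)
        = lead_coeff p * coeff p k * ((- 1) ^ (degree p - k) * s ^ k)" by simp
    then show "(- 1) ^ degree p * lead_coeff p * (coeff p k * t ^ k) = ?g k"
      by (simp only: mult_ac)
  qed simp
  finally have "(\<Sum>k\<le>degree p. ?g k) = 0" using assms(3) by simp
  moreover have "?g (degree p) \<le> (\<Sum>k\<le>degree p. ?g k)"
    using assms(2) \<open>s > 0\<close> by (intro member_le_sum) auto
  moreover have "?g (degree p) > 0"
    using assms(1) \<open>s > 0\<close> by (simp flip: power2_eq_square)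
  ultimately show False by simp
qed

section \<open>Points of high multiplicity near the cone\<close>

lemma hyperbolicity_cone_iff:
  assumes "ch f e x \<noteq> 0"
  shows "x \<in> hyperbolicity_cone f e \<longleftrightarrow> (\<forall>t. poly (ch f e x) t = 0 \<longrightarrow> t \<ge> 0)"
proof -
  have set: "set (eigenvalues f e x) = {t. poly (ch f e x) t = 0}"
    using assms by (simp add: eigenvalues_def set_count_proots)
  have "sorted (eigenvalues f e x)" by (simp add: eigenvalues_def)
  then have "x \<in> hyperbolicity_cone f e \<longleftrightarrow> (\<forall>t\<in>set (eigenvalues f e x). t \<ge> 0)"
    by (cases "eigenvalues f e x") (auto simp: hyperbolicity_cone_def eigenvalue_def)
  then show ?thesis by (simp add: set)
qed

text \<open>
  This is the geometric content of the theorem: an eigenvalue that is positive at \<open>y\<close> stays positive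
  nearby, and at a nearby point of \<open>\<Gamma>\<^sub>m\<close> all other eigenvalues are zero. The neighbourhood is cut out
  by the strict sign conditions on the coefficients from \<open>m\<close> upwards; on \<open>\<Gamma>\<^sub>m\<close> the coefficients
  below \<open>m\<close> vanish, so that there the signs still alternate weakly.
\<close>

lemma Gamma_set_locally_in_cone:
  assumes "homogeneous f d" "hyperbolic f e" "y \<in> hyperbolicity_cone f e"
  obtains U where "open U" "y \<in> U"
    "U \<inter> Gamma_set f e (root_mult f e y) \<subseteq> hyperbolicity_cone f e"
proof -
  let ?m = "root_mult f e y"
  have nz: "eval_poly f e \<noteq> 0" and rr: "real_rooted (ch f e y)"
    using assms(2) by (auto simp: hyperbolic_def)
  have deg: "degree (ch f e a) = d" for a using degree_ch[OF assms(1) nz] .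
  have lead: "coeff (ch f e a) d = eval_poly f e" for a using ch_degree_bound(2)[OF assms(1)] .
  have ch_nz: "ch f e a \<noteq> 0" for a using lead[of a] nz by auto
  define s where "s k a = (- 1) ^ (d - k) * (eval_poly f e * coeff (ch f e a) k)" for k a
  define U where "U = (\<Inter>k\<in>{?m..d}. {a. 0 < s k a})"
  have "open {a. 0 < s k a}" for k
    unfolding s_def by (intro open_Collect_less continuous_intros continuous_coeff_ch)
  then have "open U" unfolding U_def by (intro open_INT) auto
  moreover have "y \<in> U"
    using alternating_coeffs_if_nonneg_roots[OF rr ch_nz] assms(3) ch_nz
    by (auto simp: U_def s_def deg lead hyperbolicity_cone_iff root_mult_def)
  moreover have "x \<in> hyperbolicity_cone f e" if x: "x \<in> U" "x \<in> Gamma_set f e ?m" for x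
  proof -
    have "monom 1 ?m dvd ch f e x"
      using x(2) order_divides[of 0 ?m "ch f e x"]
      by (simp add: Gamma_set_def root_mult_def monom_altdef)
    then have "coeff (ch f e x) k = 0" if "k < ?m" for k
      using that by (simp add: monom_1_dvd_iff')
    then have s_nonneg: "s k x \<ge> 0" if "k \<le> d" for k
      using x(1) that by (cases "k < ?m") (auto simp: U_def s_def intro: less_imp_le)
    then have "t \<ge> 0" if "poly (ch f e x) t = 0" for t
      using nonneg_roots_if_alternating_coeffs[OF ch_nz, of x t] that s_nonneg
      by (simp add: deg lead s_def)
    then show ?thesis by (simp add: hyperbolicity_cone_iff ch_nz)
  qed
  ultimately show ?thesis using that by blast
qed

theorem theorem10:
  fixes f :: "('n::finite) rmpoly" and d :: nat and e xs :: "real ^ 'n"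
    and l :: "real ^ 'n \<Rightarrow> real" and lstar :: ereal
  assumes "homogeneous f d"
    and "hyperbolic f e"
    and "linear l"
    and "lin_indep_forms l (\<lambda>x. e \<bullet> x)"
    and "lstar = (INF x\<in>hyperbolicity_cone f e \<inter> L_set e. ereal (l x))"
    and "xs \<in> hyperbolicity_cone f e \<inter> L_set e"
    and "ereal (l xs) = lstar"
  shows "local_minimizer l (Gamma_set f e (root_mult f e xs) \<inter> L_set e) xs"
proof -
  have min: "l xs \<le> l x" if "x \<in> hyperbolicity_cone f e \<inter> L_set e" for x
  proof -
    have "ereal (l xs) \<le> ereal (l x)" unfolding assms(5,7) using that by (rule INF_lower)
    then show ?thesis by simp
  qed
  obtain U where U: "open U" "xs \<in> U"
    "U \<inter> Gamma_set f e (root_mult f e xs) \<subseteq> hyperbolicity_cone f e"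
    using Gamma_set_locally_in_cone[OF assms(1,2)] assms(6) by blast
  have "xs \<in> Gamma_set f e (root_mult f e xs) \<inter> L_set e"
    using assms(6) by (simp add: Gamma_set_def)
  moreover have "l xs \<le> l x" if "x \<in> U \<inter> (Gamma_set f e (root_mult f e xs) \<inter> L_set e)" for x
    using U(3) that by (intro min) blast
  ultimately show ?thesis using U(1,2) unfolding local_minimizer_def by blast
qed

end
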